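(* The set of separable states of $\mathcal{B}(\mathbb{C}^2\otimes\mathbb{C}^2)$ is not affinely isomorphic to the state space of any JB algebra.
   Context: States of $\mathcal{B}(\mathbb{C}^2\otimes\mathbb{C}^2)$ are identified with density operators on $\mathbb{C}^2\otimes\mathbb{C}^2$; the separable states are the convex combinations of pure product states $E\otimes F$, with $E,F$ rank-one projections on $\mathbb{C}^2$. A Jordan algebra is a real vector space with a commutative bilinear product $\circ$ satisfying $((A\circ A)\circ B)\circ A=(A\circ A)\circ(B\circ A)$. A JB algebra is a unital Jordan algebra complete with respect to a norm satisfying $\|A\circ B\|\le\|A\|\|B\|$, $\|A\circ A\|=\|A\|^2$, $\|A\circ A\|\le\|A\circ A+B\circ B\|$. A state is a continuous linear $\omega:\mathcal{A}\to\mathbb{R}$ with $\omega(I)=1$ and $\omega(A\circ A)\ge0$; the state space is the convex set of states. An affine isomorphism is a bijection preserving convex combinations. *)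

theory Defs
  imports "HOL-Analysis.Analysis" "HOL-Library.Numeral_Type"
begin

text \<open>Operators on C^2 are 2x2 complex matrices; operators on C^2 (x) C^2 are
  matrices indexed by pairs (i,j), i.e. the basis e_i (x) e_j.\<close>

type_synonym op2 = "complex ^ 2 ^ 2"
type_synonym op22 = "complex ^ (2 \<times> 2) ^ (2 \<times> 2)"

definition outer :: "complex ^ 2 \<Rightarrow> complex ^ 2 \<Rightarrow> op2" where
  "outer v w = (\<chi> i j. v $ i * cnj (w $ j))"

definition rank_one_proj :: "op2 \<Rightarrow> bool" where
  "rank_one_proj E \<longleftrightarrow> (\<exists>v. norm v = 1 \<and> E = outer v v)"

definition tensor_op :: "op2 \<Rightarrow> op2 \<Rightarrow> op22" where
  "tensor_op A B = (\<chi> p q. A $ fst p $ fst q * B $ snd p $ snd q)"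

definition separable_states :: "op22 set" where
  "separable_states =
     convex hull {tensor_op E F | E F. rank_one_proj E \<and> rank_one_proj F}"

definition JB_algebra :: "('a::banach \<Rightarrow> 'a \<Rightarrow> 'a) \<Rightarrow> 'a \<Rightarrow> bool" where
  "JB_algebra jp u \<longleftrightarrow>
     bilinear jp \<and>
     (\<forall>A B. jp A B = jp B A) \<and>
     (\<forall>A B. jp (jp (jp A A) B) A = jp (jp A A) (jp B A)) \<and>
     (\<forall>A. jp u A = A) \<and>
     (\<forall>A B. norm (jp A B) \<le> norm A * norm B) \<and>
     (\<forall>A. norm (jp A A) = (norm A)\<^sup>2) \<and>
     (\<forall>A B. norm (jp A A) \<le> norm (jp A A + jp B B))"

definition JB_states :: "('a::banach \<Rightarrow> 'a \<Rightarrow> 'a) \<Rightarrow> 'a \<Rightarrow> ('a \<Rightarrow> real) set" where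
  "JB_states jp u =
     {\<omega>. bounded_linear \<omega> \<and> \<omega> u = 1 \<and> (\<forall>A. \<omega> (jp A A) \<ge> 0)}"

definition affine_iso :: "('b::real_vector \<Rightarrow> ('a \<Rightarrow> real)) \<Rightarrow> 'b set \<Rightarrow> ('a \<Rightarrow> real) set \<Rightarrow> bool" where
  "affine_iso f S T \<longleftrightarrow> bij_betw f S T \<and>
     (\<forall>x\<in>S. \<forall>y\<in>S. \<forall>t::real. 0 \<le> t \<and> t \<le> 1 \<longrightarrow>
        f (t *\<^sub>R x + (1 - t) *\<^sub>R y) = (\<lambda>a. t * f x a + (1 - t) * f y a))"

end

theory Submission
  imports Defs
begin

text \<open>In a JB algebra, let \<open>p\<close> be an idempotent and let \<open>x\<close> vanish on all states that take
  the value \<open>0\<close> or \<open>1\<close> at \<open>p\<close>. Both Peirce components of \<open>x\<close> in the corners of \<open>p\<close> and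
  \<open>u - p\<close> then vanish, so \<open>p \<circ> x = x/2\<close>. If the separable states were the
  state space, every real linear functional on matrices would be given by an element of the
  algebra. The four diagonal entries would give idempotents \<open>p\<close> with sum \<open>u\<close>: the square of
  each is dominated by a multiple of it and therefore proportional to it. The real part of the
  entry \<open>((1,1),(2,2))\<close> would give a nonzero \<open>x\<close> to which the above applies for each of the
  four, and summing yields \<open>x = 2x\<close>.\<close>

subsection \<open>The Hahn--Banach theorem\<close>

definition sublinear :: "('a::real_vector \<Rightarrow> real) \<Rightarrow> bool" where
  "sublinear q \<longleftrightarrow> (\<forall>x y. q (x + y) \<le> q x + q y) \<and> (\<forall>x. \<forall>t>0. q (t *\<^sub>R x) \<le> t * q x) \<and> q 0 = 0"

lemma sublinear_scale:
  assumes "sublinear q" "t > 0"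
  shows "q (t *\<^sub>R x) = t * q x"
proof -
  have "q ((1/t) *\<^sub>R (t *\<^sub>R x)) \<le> (1/t) * q (t *\<^sub>R x)"
    using assms unfolding sublinear_def by (meson divide_pos_pos zero_less_one)
  then have "q x \<le> q (t *\<^sub>R x) / t" using assms(2) by simp
  then have "t * q x \<le> q (t *\<^sub>R x)" using assms(2) by (simp add: field_simps)
  moreover have "q (t *\<^sub>R x) \<le> t * q x" using assms by (simp add: sublinear_def)
  ultimately show ?thesis by simp
qed

lemma sublinear_minus:
  assumes "sublinear q" shows "- q (- x) \<le> q x"
proof -
  have "q (x + - x) \<le> q x + q (- x)" using assms unfolding sublinear_def by blast
  then show ?thesis using assms by (simp add: sublinear_def)
qed

text \<open>Taking the infimum over \<open>t >= 0\<close> of \<open>q (x + t z) - t q z\<close>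
  lowers \<open>q\<close> in the direction \<open>- z\<close>: \<open>t = 0\<close> gives
  \<open>q' <= q\<close>, and \<open>t = 1\<close> at \<open>x = - z\<close> gives
  \<open>- q z\<close>. Subadditivity keeps the infimum above \<open>- q (- x)\<close>.\<close>

lemma sublinear_lower:
  assumes q: "sublinear q"
  obtains q' where "sublinear q'" "\<And>x. q' x \<le> q x" "q' (- z) \<le> - q z"
proof -
  define A where "A x = (\<lambda>t. q (x + t *\<^sub>R z) - t * q z) ` {0..}" for x
  define q' where "q' x = Inf (A x)" for x
  have sub: "q (x + y) \<le> q x + q y" for x y using q by (simp add: sublinear_def)
  have tz: "q (t *\<^sub>R z) = t * q z" if "t \<ge> 0" for t
    using sublinear_scale[OF q, of t z] that q by (cases "t = 0") (auto simp: sublinear_def)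
  have lb: "- q (- x) \<le> q (x + t *\<^sub>R z) - t * q z" if "t \<ge> 0" for x t
    using sub[of "x + t *\<^sub>R z" "- x"] tz[OF that] by simp
  have bdd: "bdd_below (A x)" for x unfolding A_def using lb by (intro bdd_belowI) auto
  have le: "q' x \<le> q (x + t *\<^sub>R z) - t * q z" if "t \<ge> 0" for x t
    unfolding q'_def by (rule cInf_lower[OF _ bdd]) (auto simp: A_def that)
  have ge: "c \<le> q' x" if "\<And>t. t \<ge> 0 \<Longrightarrow> c \<le> q (x + t *\<^sub>R z) - t * q z" for c x
    unfolding q'_def by (rule cInf_greatest) (auto simp: A_def that)
  have "q' (x + y) \<le> q' x + q' y" for x y
  proof -
    have "q' (x + y) - (q (y + s *\<^sub>R z) - s * q z) \<le> q' x" if "s \<ge> 0" for s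
    proof (rule ge)
      fix t :: real assume "t \<ge> 0"
      then have "q' (x + y) \<le> q (x + y + (t + s) *\<^sub>R z) - (t + s) * q z" using that by (intro le) auto
      moreover have "q ((x + t *\<^sub>R z) + (y + s *\<^sub>R z)) \<le> q (x + t *\<^sub>R z) + q (y + s *\<^sub>R z)" by (rule sub)
      ultimately show "q' (x + y) - (q (y + s *\<^sub>R z) - s * q z) \<le> q (x + t *\<^sub>R z) - t * q z"
        by (simp add: algebra_simps)
    qed
    then have "q' (x + y) - q' x \<le> q (y + s *\<^sub>R z) - s * q z" if "s \<ge> 0" for s
      using that by (smt (verit))
    then have "q' (x + y) - q' x \<le> q' y" by (rule ge)
    then show ?thesis by simp
  qed
  moreover have "q' (t *\<^sub>R x) \<le> t * q' x" if "t > 0" for t x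
  proof -
    have "q' (t *\<^sub>R x) / t \<le> q' x"
    proof (rule ge)
      fix s :: real assume s: "s \<ge> 0"
      have "q' (t *\<^sub>R x) \<le> q (t *\<^sub>R x + (t * s) *\<^sub>R z) - (t * s) * q z"
        using s that by (intro le) auto
      also have "t *\<^sub>R x + (t * s) *\<^sub>R z = t *\<^sub>R (x + s *\<^sub>R z)" by (simp add: algebra_simps)
      also have "q \<dots> = t * q (x + s *\<^sub>R z)" by (rule sublinear_scale[OF q that])
      finally show "q' (t *\<^sub>R x) / t \<le> q (x + s *\<^sub>R z) - s * q z"
        using that by (simp add: field_simps)
    qed
    then show ?thesis using that by (simp add: field_simps)
  qed
  moreover have "q' 0 = 0"
  proof (rule antisym)
    show "q' 0 \<le> 0" using le[of 0 0] q by (simp add: sublinear_def)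
    show "0 \<le> q' 0" by (rule ge) (simp add: tz)
  qed
  ultimately have "sublinear q'" by (auto simp: sublinear_def)
  moreover have "q' x \<le> q x" for x using le[of 0 x] by simp
  moreover have "q' (- z) \<le> - q z" using le[of 1 "- z"] q by (simp add: sublinear_def)
  ultimately show thesis using that by blast
qed

text \<open>Provides the bounds of chains for Zorn's lemma. Subadditivity comes from the chain
  condition: of two members \<open>q\<close> and \<open>r\<close>, the smaller one bounds the
  infimum at \<open>x + y\<close> by \<open>q x + r y\<close>. The common bound \<open>p\<close>
  keeps the infimum at \<open>x\<close> above \<open>- p (- x)\<close>.\<close>

lemma sublinear_INF:
  assumes C: "C \<noteq> {}" "\<And>q. q \<in> C \<Longrightarrow> sublinear q" 
    and chain: "\<And>q r. q \<in> C \<Longrightarrow> r \<in> C \<Longrightarrow> q \<le> r \<or> r \<le> q"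
    and p: "\<And>q. q \<in> C \<Longrightarrow> q \<le> p"
  shows "sublinear (\<lambda>x. INF q\<in>C. q x)" (is "sublinear ?q")
    and "q \<in> C \<Longrightarrow> (\<lambda>x. INF q\<in>C. q x) \<le> q"
proof -
  have bdd: "bdd_below ((\<lambda>q. q x) ` C)" for x
  proof (rule bdd_belowI2)
    fix q assume "q \<in> C"
    then show "- p (- x) \<le> q x" 
      using sublinear_minus[OF C(2), of q x] p[of q] by (smt (verit) le_funD)
  qed
  have le: "?q x \<le> q x" if "q \<in> C" for q x by (rule cINF_lower[OF bdd that])
  show "q \<in> C \<Longrightarrow> ?q \<le> q" using le by (auto simp: le_fun_def)
  have ge: "c \<le> ?q x" if "\<And>q. q \<in> C \<Longrightarrow> c \<le> q x" for c x
    by (rule cINF_greatest[OF C(1) that])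
  have "?q (x + y) \<le> ?q x + ?q y" for x y
  proof -
    have "?q (x + y) - r y \<le> ?q x" if r: "r \<in> C" for r
    proof (rule ge)
      fix q assume q: "q \<in> C"
      have sq: "q (x + y) \<le> q x + q y" "r (x + y) \<le> r x + r y"
        using C(2)[OF q] C(2)[OF r] by (auto simp: sublinear_def)
      from chain[OF q r] show "?q (x + y) - r y \<le> q x"
      proof
        assume "q \<le> r" then show ?thesis using sq le[OF q, of "x + y"] le_funD[of q r y] by simp
      next
        assume "r \<le> q" then show ?thesis using sq le[OF r, of "x + y"] le_funD[of r q x] by simp
      qed
    qed
    then have "?q (x + y) - ?q x \<le> r y" if "r \<in> C" for r using that by (smt (verit))
    then have "?q (x + y) - ?q x \<le> ?q y" by (rule ge)
    then show ?thesis by simp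
  qed
  moreover have "?q (t *\<^sub>R x) \<le> t * ?q x" if t: "t > 0" for t x
  proof -
    have "?q (t *\<^sub>R x) / t \<le> ?q x"
    proof (rule ge)
      fix q assume q: "q \<in> C"
      then show "?q (t *\<^sub>R x) / t \<le> q x"
        using le[OF q, of "t *\<^sub>R x"] sublinear_scale[OF C(2)[OF q] t, of x] t by (simp add: field_simps)
    qed
    then show ?thesis using t by (simp add: field_simps)
  qed
  moreover have "?q 0 = 0"
  proof -
    have "(\<lambda>q. q 0) ` C = {0}" using C by (auto simp: sublinear_def image_iff)
    then show ?thesis by simp
  qed
  ultimately show "sublinear ?q" by (auto simp: sublinear_def)
qed

text \<open>A sublinear functional that is minimal below \<open>p\<close> cannot be lowered along any \<open>z\<close>, so it
  is odd and hence linear.\<close>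

theorem hahn_banach:
  assumes p: "sublinear p"
  obtains f where "linear f" "\<And>x. f x \<le> p x"
proof -
  define A where "A = {q. sublinear q \<and> q \<le> p}"
  \<comment> \<open>The order is reversed, so the maximal element supplied by Zorn's lemma is a
    minimal sublinear functional.\<close>
  let ?P = "\<lambda>q r :: 'a \<Rightarrow> real. r \<le> q"
  have "\<exists>m\<in>A. \<forall>a\<in>A. ?P m a \<longrightarrow> a = m"
  proof (rule predicate_Zorn)
    show "partial_order_on A (relation_of ?P A)"
      by (rule partial_order_on_relation_ofI) auto
    fix C assume "C \<in> Chains (relation_of ?P A)"
    then have C: "C \<subseteq> A" "\<And>q r. q \<in> C \<Longrightarrow> r \<in> C \<Longrightarrow> q \<le> r \<or> r \<le> q"
      by (auto simp: Chains_def relation_of_def)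
    show "\<exists>u\<in>A. \<forall>a\<in>C. ?P a u"
    proof (cases "C = {}")
      case True
      then show ?thesis using p by (auto simp: A_def)
    next
      case False
      note I = sublinear_INF[OF False _ C(2), of p]
      have s: "sublinear (\<lambda>x. INF q\<in>C. q x)" using C(1) by (intro I(1)) (auto simp: A_def)
      have l: "(\<lambda>x. INF q\<in>C. q x) \<le> q" if "q \<in> C" for q
        using C(1) that by (intro I(2)) (auto simp: A_def)
      obtain q where q: "q \<in> C" using False by auto
      then have "q \<le> p" using C(1) by (auto simp: A_def)
      then have "(\<lambda>x. INF q\<in>C. q x) \<in> A" unfolding A_def using s l[OF q] by (auto intro: order_trans)
      then show ?thesis using l by blast
    qed
  qed
  then obtain m where m: "sublinear m" "m \<le> p" and min: "\<And>a. sublinear a \<Longrightarrow> a \<le> m \<Longrightarrow> a = m"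
    unfolding A_def by (auto intro: order_trans)
  have neg: "m (- z) = - m z" for z
  proof -
    obtain q' where q': "sublinear q'" "\<And>x. q' x \<le> m x" "q' (- z) \<le> - m z"
      using sublinear_lower[OF m(1)] by metis
    then have "q' = m" by (intro min) (auto simp: le_fun_def)
    then show ?thesis using q'(3) sublinear_minus[OF m(1), of z] by simp
  qed
  have "m (x + y) = m x + m y" for x y
  proof -
    have "m (x + y) \<le> m x + m y" "m (- x + - y) \<le> m (- x) + m (- y)"
      using m(1) unfolding sublinear_def by blast+
    then show ?thesis using neg[of x] neg[of y] neg[of "x + y"] by simp
  qed
  moreover have "m (t *\<^sub>R x) = t * m x" for t x
    using sublinear_scale[OF m(1), of t x] sublinear_scale[OF m(1), of "- t" x] neg[of "t *\<^sub>R x"] m(1)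
    by (cases t "0::real" rule: linorder_cases) (auto simp: sublinear_def)
  ultimately have "linear m" by (intro linearI) auto
  moreover have "m x \<le> p x" for x using m(2) by (rule le_funD)
  ultimately show thesis using that by blast
qed

text \<open>Lowering the norm along \<open>z\<close> before applying Hahn-Banach gives
  \<open>f (- z) <= - norm z\<close>, which forces equality at \<open>z\<close>.\<close>

lemma norm_attaining_functional:
  fixes z :: "'a::real_normed_vector"
  obtains f where "linear f" "\<And>x. f x \<le> norm x" "f z = norm z"
proof -
  have "sublinear (norm :: 'a \<Rightarrow> real)" by (auto simp: sublinear_def norm_triangle_ineq)
  then obtain q where q: "sublinear q" "\<And>x. q x \<le> norm x" "q (- z) \<le> - norm z"
    using sublinear_lower by metis
  obtain f where f: "linear f" "\<And>x. f x \<le> q x" using hahn_banach[OF q(1)] by blast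
  have "f x \<le> norm x" for x using f(2) q(2) by (rule order_trans)
  moreover from this have "f z = norm z"
    using order_trans[OF f(2) q(3)] linear_neg[OF f(1), of z] by (intro antisym) auto
  ultimately show thesis using that f(1) by blast
qed

subsection \<open>States and idempotents of a JB algebra\<close>

locale jb_algebra =
  fixes jp :: "'a::banach \<Rightarrow> 'a \<Rightarrow> 'a" (infixl "\<odot>" 70) and u :: 'a
  assumes JB: "JB_algebra jp u"
begin

section \<open>Calculus with the Jordan product\<close>

lemma bilinear_jp: "bilinear jp"
  using JB by (simp add: JB_algebra_def)

lemmas jp_add_left = bilinear_ladd[OF bilinear_jp]
  and jp_add_right = bilinear_radd[OF bilinear_jp]
  and jp_diff_left = bilinear_lsub[OF bilinear_jp]
  and jp_diff_right = bilinear_rsub[OF bilinear_jp]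
  and jp_scale_left = bilinear_lmul[OF bilinear_jp]
  and jp_scale_right = bilinear_rmul[OF bilinear_jp]
  and jp_zero_left [simp] = bilinear_lzero[OF bilinear_jp]
  and jp_zero_right [simp] = bilinear_rzero[OF bilinear_jp]

lemmas jp_linear = jp_add_left jp_add_right jp_diff_left jp_diff_right jp_scale_left jp_scale_right

lemma jp_commute: "a \<odot> b = b \<odot> a"
  and jordan_identity: "((a \<odot> a) \<odot> b) \<odot> a = (a \<odot> a) \<odot> (b \<odot> a)"
  and unit_left [simp]: "u \<odot> a = a"
  and norm_jp_le: "norm (a \<odot> b) \<le> norm a * norm b"
  and norm_square: "norm (a \<odot> a) = (norm a)\<^sup>2"
  and norm_square_le: "norm (a \<odot> a) \<le> norm (a \<odot> a + b \<odot> b)"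
  using JB unfolding JB_algebra_def by blast+

lemma unit_right [simp]: "a \<odot> u = a"
  using jp_commute unit_left by metis

lemma norm_idem_le:
  assumes "e \<odot> e = e" shows "norm e \<le> 1"
  using norm_square[of e] assms by (auto simp: power2_eq_square)

lemma square_add: "(a + b) \<odot> (a + b) = a \<odot> a + 2 *\<^sub>R (a \<odot> b) + b \<odot> b"
  by (simp add: jp_linear jp_commute[of b a] scaleR_2)

lemma square_diff: "(a - b) \<odot> (a - b) = a \<odot> a - 2 *\<^sub>R (a \<odot> b) + b \<odot> b"
  by (simp add: jp_linear jp_commute[of b a] scaleR_2)

lemma square_scale: "(t *\<^sub>R a) \<odot> (t *\<^sub>R a) = t\<^sup>2 *\<^sub>R (a \<odot> a)"
  by (simp add: jp_linear power2_eq_square)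

text \<open>Polarization: the Jordan identity at \<open>a + c\<close> minus that at
  \<open>a - c\<close> leaves twice the part odd in \<open>c\<close>. Its cubic part is the identity
  at \<open>c\<close>; removing it leaves the part linear in \<open>c\<close>.\<close>

lemma jordan_linearized:
  "2 *\<^sub>R (((a \<odot> c) \<odot> b) \<odot> a) + ((a \<odot> a) \<odot> b) \<odot> c
    = 2 *\<^sub>R ((a \<odot> c) \<odot> (b \<odot> a)) + (a \<odot> a) \<odot> (b \<odot> c)" (is "?l = ?r")
proof -
  have "2 *\<^sub>R ?l = ((a + c) \<odot> (a + c) \<odot> b) \<odot> (a + c) - ((a - c) \<odot> (a - c) \<odot> b) \<odot> (a - c)
      - 2 *\<^sub>R ((c \<odot> c \<odot> b) \<odot> c)"
    by (simp only: square_add square_diff) (simp add: jp_linear scaleR_2 algebra_simps)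
  also have "\<dots> = 2 *\<^sub>R ?r"
    unfolding jordan_identity
    by (simp only: square_add square_diff) (simp add: jp_linear scaleR_2 algebra_simps)
  finally show ?thesis by simp
qed

section \<open>Peirce corners (eigenvalue 1 of multiplication by \<open>e\<close>) and square roots
  in them\<close>

definition corner :: "'a \<Rightarrow> 'a set" where
  "corner e = {z. e \<odot> z = z}"

lemma cornerD: "z \<in> corner e \<Longrightarrow> e \<odot> z = z" "z \<in> corner e \<Longrightarrow> z \<odot> e = z"
  by (simp_all add: corner_def jp_commute)

text \<open>Lets results about corners be used for the whole algebra, as the case
  \<open>e = u\<close>.\<close>

lemma corner_unit [simp]: "corner u = UNIV"
  by (auto simp: corner_def)

lemma subspace_corner: "subspace (corner e)"
  by (auto simp: subspace_def corner_def jp_linear)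

lemma bounded_linear_jp: "bounded_linear (\<lambda>x. a \<odot> x)"
  by (rule bounded_linear_intro[where K = "norm a"])
     (simp_all add: jp_linear norm_jp_le mult.commute[of "norm _" "norm a"])

lemma closed_corner: "closed (corner e)"
  unfolding corner_def
  by (intro closed_Collect_eq continuous_intros linear_continuous_on bounded_linear_jp)

text \<open>With \<open>e\<close> as the repeated variable the linearized identity reads
  \<open>2 e(ab) + ab = 2 ab + e(ab)\<close>.\<close>

lemma corner_jp_closed:
  assumes e: "e \<odot> e = e" and "a \<in> corner e" "b \<in> corner e"
  shows "a \<odot> b \<in> corner e"
proof -
  have "e \<odot> (a \<odot> b) = a \<odot> b"
    using jordan_linearized[of e a b] assms by (simp add: corner_def jp_commute scaleR_2)
  then show ?thesis by (simp add: corner_def)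
qed

text \<open>For \<open>L\<close> the multiplication by \<open>e\<close>, the linearized identity
  becomes \<open>L (L - 1) (2 L - 1) = 0\<close>, whence the Peirce eigenvalues 0, 1/2 and
  1.\<close>

lemma peirce_polynomial:
  assumes e: "e \<odot> e = e"
  shows "2 *\<^sub>R (e \<odot> (e \<odot> (e \<odot> x))) = 2 *\<^sub>R (e \<odot> (e \<odot> x)) + e \<odot> (e \<odot> x) - e \<odot> x"
  using jordan_linearized[of e x e] e by (simp add: jp_commute algebra_simps)

text \<open>\<open>L (2 L - 1)\<close> is the Peirce projection onto the corner: by the cubic
  equation it maps into the kernel of \<open>L - 1\<close>.\<close>

lemma peirce_corner:
  assumes e: "e \<odot> e = e"
  shows "2 *\<^sub>R (e \<odot> (e \<odot> x)) - e \<odot> x \<in> corner e"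
  using peirce_polynomial[OF e, of x] by (simp add: corner_def jp_linear)

text \<open>Writing \<open>b = e - y\<close>, the equation \<open>b\<^sup>2 = e - z\<close> says that \<open>y\<close> is a fixed point of
  \<open>y \<mapsto> (z + y\<^sup>2) / 2\<close>, which contracts a small ball; associativity plays no role.\<close>

lemma corner_sqrt:
  assumes e: "e \<odot> e = e" and z: "z \<in> corner e" "norm z < 1"
  obtains b where "b \<in> corner e" "b \<odot> b = e - z"
proof -
  \<comment> \<open>\<open>r\<close> is the smaller root of \<open>r^2 - 2 r + norm z = 0\<close>.
    Hence \<open>T\<close> maps the ball of radius \<open>r\<close> into itself, and
    \<open>r < 1\<close> is also a Lipschitz constant there.\<close>
  define r where "r = 1 - sqrt (1 - norm z)"
  define T where "T y = (1/2) *\<^sub>R (z + y \<odot> y)" for y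
  define D where "D = corner e \<inter> cball 0 r"
  have r: "0 \<le> r" "r < 1" using z(2) by (auto simp: r_def)
  have "(sqrt (1 - norm z))\<^sup>2 = 1 - norm z" using z(2) by simp
  then have rr: "norm z + r\<^sup>2 = 2 * r" by (simp add: r_def power2_diff)
  have "\<exists>!y\<in>D. T y = y"
  proof (rule Banach_fix)
    show "complete D" unfolding D_def complete_eq_closed by (intro closed_Int closed_corner closed_cball)
    show "D \<noteq> {}" using r subspace_0[OF subspace_corner[of e]] by (auto simp: D_def)
    show "0 \<le> r" "r < 1" by (fact r)+
    show "T ` D \<subseteq> D"
    proof safe
      fix y assume y: "y \<in> D"
      have "norm (z + y \<odot> y) \<le> norm z + (norm y)\<^sup>2"
        using norm_triangle_ineq[of z "y \<odot> y"] by (simp add: norm_square)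
      also have "\<dots> \<le> norm z + r\<^sup>2" using y by (simp add: D_def power_mono)
      finally have "norm (T y) \<le> r" using rr by (simp add: T_def)
      moreover have "T y \<in> corner e"
        unfolding T_def using y
        by (intro subspace_scale subspace_add subspace_corner z corner_jp_closed e) (auto simp: D_def)
      ultimately show "T y \<in> D" by (simp add: D_def)
    qed
    fix x y assume xy: "x \<in> D" "y \<in> D"
    have "T x - T y = (1/2) *\<^sub>R ((x - y) \<odot> (x + y))"
      by (simp add: T_def jp_linear jp_commute[of y x] algebra_simps)
    then have "norm (T x - T y) \<le> norm (x - y) * norm (x + y) / 2"
      using norm_jp_le[of "x - y" "x + y"] by simp
    also have "\<dots> \<le> norm (x - y) * (2 * r) / 2"
      using xy norm_triangle_ineq[of x y] by (intro divide_right_mono mult_left_mono) (auto simp: D_def)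
    finally show "dist (T x) (T y) \<le> r * dist x y" by (simp add: dist_norm mult.commute)
  qed
  then obtain y where y: "y \<in> D" "T y = y" by blast
  have "e \<in> corner e" using e by (simp add: corner_def)
  have "2 *\<^sub>R T y = z + y \<odot> y" by (simp add: T_def)
  then have "2 *\<^sub>R y = z + y \<odot> y" by (simp only: y(2))
  moreover have "(e - y) \<odot> (e - y) = e - 2 *\<^sub>R y + y \<odot> y"
    using y(1) e by (simp add: square_diff D_def cornerD)
  ultimately have "(e - y) \<odot> (e - y) = e - z" by simp
  moreover have "e - y \<in> corner e"
    using y(1) \<open>e \<in> corner e\<close> by (auto simp: D_def intro: subspace_diff subspace_corner)
  ultimately show thesis using that by blast
qed

lemma unit_sqrt:
  assumes "norm z < 1"
  obtains b where "b \<odot> b = u - z"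
  using corner_sqrt[of u z] assms by auto

section \<open>Positivity, norm and existence of states\<close>

abbreviation states :: "('a \<Rightarrow> real) set" where
  "states \<equiv> JB_states jp u"

lemma stateD:
  assumes "\<omega> \<in> states"
  shows "linear \<omega>" "\<omega> u = 1" "0 \<le> \<omega> (a \<odot> a)"
  using assms by (auto simp: JB_states_def bounded_linear.linear)

text \<open>For every \<open>s > norm x\<close> the element \<open>u - x / s\<close> is a square, so
  a state is nonnegative on it.\<close>

lemma state_le_norm:
  assumes \<omega>: "\<omega> \<in> states"
  shows "\<omega> x \<le> norm x"
proof (rule field_le_epsilon)
  fix d :: real assume d: "d > 0"
  let ?s = "norm x + d"
  have s: "?s > 0" using d by (simp add: add_nonneg_pos)
  then have "norm (x /\<^sub>R ?s) < 1" using d by (simp add: field_simps)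
  then obtain b where "b \<odot> b = u - x /\<^sub>R ?s" by (rule unit_sqrt)
  then have "0 \<le> 1 - \<omega> x / ?s"
    using stateD(3)[OF \<omega>, of b] stateD(1,2)[OF \<omega>]
    by (simp add: linear_diff linear_scale divide_inverse mult.commute)
  then show "\<omega> x \<le> ?s" using s by (simp add: field_simps)
qed

lemma state_cauchy_schwarz:
  assumes \<omega>: "\<omega> \<in> states"
  shows "(\<omega> x)\<^sup>2 \<le> \<omega> (x \<odot> x)"
  using stateD(3)[OF \<omega>, of "x - \<omega> x *\<^sub>R u"] stateD(1,2)[OF \<omega>]
  by (simp add: square_diff jp_linear linear_diff linear_add linear_scale power2_eq_square)

text \<open>The value at the square of \<open>t a + b\<close> is affine in \<open>t\<close> once its
  quadratic term vanishes, and a nonnegative affine function has slope 0.\<close>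

lemma state_null_square:
  assumes \<omega>: "\<omega> \<in> states" and 0: "\<omega> (a \<odot> a) = 0"
  shows "\<omega> (a \<odot> b) = 0"
proof (rule ccontr)
  assume n: "\<omega> (a \<odot> b) \<noteq> 0"
  have "0 \<le> 2 * t * \<omega> (a \<odot> b) + \<omega> (b \<odot> b)" for t
    using stateD(3)[OF \<omega>, of "t *\<^sub>R a + b"] stateD(1)[OF \<omega>] 0
    by (simp add: square_add square_scale linear_add linear_scale jp_scale_left power2_eq_square jp_scale_right)
  \<comment> \<open>This \<open>t\<close> makes the right-hand side equal to -1.\<close>
  from this[of "- (\<omega> (b \<odot> b) + 1) / (2 * \<omega> (a \<odot> b))"] show False using n by (simp add: field_simps)
qed

text \<open>Positivity comes from \<open>norm_square_le\<close>: if \<open>norm b < 1\<close>, then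
  \<open>u - b^2\<close> is a square \<open>c^2\<close> with
  \<open>norm (c^2) <= norm (c^2 + b^2) = norm u <= 1\<close>, so
  \<open>f (u - b^2) <= 1 = f u\<close>.\<close>

lemma stateI:
  assumes f: "linear f" "\<And>x. f x \<le> norm x" "f u = 1"
  shows "f \<in> states"
proof -
  have "\<bar>f x\<bar> \<le> norm x" for x
    using f(2)[of x] f(2)[of "- x"] linear_neg[OF f(1), of x] by simp
  then have "bounded_linear f"
    using f(1) by (intro bounded_linear_intro[where K = 1]) (auto simp: linear_add linear_scale)
  moreover have "0 \<le> f (a \<odot> a)" for a
  proof -
    define s where "s = norm a + 1"
    have s: "s > 0" by (simp add: s_def add_nonneg_pos)
    let ?b = "a /\<^sub>R s"
    have b: "norm ?b < 1" using s by (simp add: s_def field_simps)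
    then have "norm (?b \<odot> ?b) < 1" by (simp add: norm_square power_less_one_iff)
    then obtain c where c: "c \<odot> c = u - ?b \<odot> ?b" by (rule unit_sqrt)
    have "norm (c \<odot> c) \<le> 1"
      using norm_square_le[of c ?b] norm_idem_le[of u] by (simp add: c)
    then have "f (c \<odot> c) \<le> 1" using f(2) order_trans by blast
    then have "0 \<le> f (?b \<odot> ?b)" using f by (simp add: c linear_diff)
    then have "0 \<le> f (a \<odot> a) / s\<^sup>2" unfolding square_scale using f(1) by (simp add: linear_scale power_inverse divide_inverse mult.commute)
    then show ?thesis using s by (simp add: zero_le_divide_iff)
  qed
  ultimately show ?thesis using f(3) by (simp add: JB_states_def)
qed

text \<open>If \<open>norm (u + w) < k\<close>, then \<open>k u - (u + w)\<close> is a square;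
  adding it to the square \<open>w\<close> gives \<open>(k - 1) u\<close>. Adding a square to a
  square does not decrease the norm, so \<open>norm w <= k - 1\<close>.\<close>

lemma norm_unit_add_square:
  assumes w: "w = a \<odot> a" "w \<noteq> 0"
  shows "1 + norm w \<le> norm (u + w)"
proof (rule ccontr)
  assume lt: "\<not> 1 + norm w \<le> norm (u + w)"
  \<comment> \<open>The maximum with 1 ensures \<open>k > 1\<close>, so that
    \<open>(k - 1) u\<close> has norm at most \<open>k - 1\<close>; \<open>w \<noteq> 0\<close>
    leaves room for \<open>k\<close> below \<open>1 + norm w\<close>.\<close>
  define k where "k = (max 1 (norm (u + w)) + (1 + norm w)) / 2"
  have k: "k > 1" "norm (u + w) < k" "k < 1 + norm w"
    using lt w(2) by (auto simp: k_def max_def)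
  have "norm ((u + w) /\<^sub>R k) < 1" using k by (simp add: inverse_eq_divide divide_less_eq del: scaleR_right_distrib scaleR_add_right)
  then obtain d where d: "d \<odot> d = u - (u + w) /\<^sub>R k" by (rule unit_sqrt)
  have "(sqrt k *\<^sub>R d) \<odot> (sqrt k *\<^sub>R d) = k *\<^sub>R u - (u + w)"
    using k by (simp add: square_scale d scaleR_diff_right)
  then have "w + (sqrt k *\<^sub>R d) \<odot> (sqrt k *\<^sub>R d) = (k - 1) *\<^sub>R u" by (simp add: algebra_simps)
  then have "norm w \<le> norm ((k - 1) *\<^sub>R u)" using norm_square_le[of a "sqrt k *\<^sub>R d"] w(1) by simp
  also have "\<dots> \<le> (k - 1) * 1" using k norm_idem_le[of u] by (simp add: mult_left_le)
  finally show False using k by simp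
qed

text \<open>Let \<open>w = a \<odot> a\<close>. A functional attaining the norm at
  \<open>u + w\<close> must have \<open>f u = 1\<close> and \<open>f w = norm w\<close>, because
  \<open>norm (u + w) >= 1 + norm w\<close>. For \<open>0 < t < 1\<close> the element
  \<open>e - (t / norm w) w\<close> is a square, so \<open>f e >= t\<close>.\<close>

lemma corner_square_state:
  assumes e: "e \<odot> e = e" and a: "a \<in> corner e" "a \<odot> a \<noteq> 0"
  obtains \<omega> where "\<omega> \<in> states" "\<omega> e = 1" "\<omega> (a \<odot> a) = norm (a \<odot> a)"
proof -
  let ?w = "a \<odot> a"
  obtain f where f: "linear f" "\<And>x. f x \<le> norm x" "f (u + ?w) = norm (u + ?w)"
    using norm_attaining_functional by metis
  have "f u \<le> 1" "f ?w \<le> norm ?w" using f(2)[of u] f(2)[of ?w] norm_idem_le[of u] by auto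
  then have fu: "f u = 1" "f ?w = norm ?w"
    using norm_unit_add_square[OF refl a(2)] f(3) linear_add[OF f(1), of u ?w] by auto
  have st: "f \<in> states" using f(1,2) fu(1) by (rule stateI)
  have "1 \<le> f e"
  proof (rule field_le_mult_one_interval)
    fix t :: real assume t: "0 < t" "t < 1"
    let ?z = "(t / norm ?w) *\<^sub>R ?w"
    have "norm ?z < 1" "?z \<in> corner e"
      using t a e by (auto intro: subspace_scale subspace_corner corner_jp_closed)
    then obtain b where "b \<odot> b = e - ?z" using corner_sqrt[OF e] by metis
    then have "0 \<le> f e - f ?z" using stateD(3)[OF st, of b] f(1) by (simp add: linear_diff)
    also have "f ?z = t" using f(1) fu(2) a(2) by (simp add: linear_scale)
    finally show "t * 1 \<le> f e" by simp
  qed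
  then have "f e = 1" using f(2)[of e] norm_idem_le[OF e] by simp
  then show thesis using that st fu(2) by blast
qed

text \<open>With \<open>z\<close> scaled to \<open>y\<close> of norm 1/2, \<open>e - y\<close> is a
  square; its norm, if nonzero, is attained at a state with value 1 at \<open>e\<close> and 0 at
  \<open>y\<close>, so it is at most 1. A state attaining the norm 1/4 of \<open>y^2\<close> gives
  \<open>(e - y)^2\<close> the value \<open>1 + 1/4\<close>, which exceeds its norm.\<close>

lemma corner_zero:
  assumes e: "e \<odot> e = e" and z: "z \<in> corner e"
    and 0: "\<And>\<omega>. \<omega> \<in> states \<Longrightarrow> \<omega> e = 1 \<Longrightarrow> \<omega> z = 0"
  shows "z = 0"
proof (rule ccontr)
  assume "z \<noteq> 0"
  define y where "y = (1 / (2 * norm z)) *\<^sub>R z"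
  have y: "norm y = 1/2" "y \<in> corner e"
    using \<open>z \<noteq> 0\<close> z by (auto simp: y_def intro: subspace_scale subspace_corner)
  have y0: "\<omega> y = 0" if "\<omega> \<in> states" "\<omega> e = 1" for \<omega>
    using 0[OF that] stateD(1)[OF that(1)] by (simp add: y_def linear_scale)
  obtain b where b: "b \<in> corner e" "b \<odot> b = e - y" using corner_sqrt[OF e y(2)] y(1) by auto
  have "norm (e - y) \<le> 1"
  proof (cases "e - y = 0")
    case False
    then obtain \<omega> where \<omega>: "\<omega> \<in> states" "\<omega> e = 1" "\<omega> (e - y) = norm (e - y)"
      using corner_square_state[OF e b(1)] b(2) by metis
    then show ?thesis using y0[OF \<omega>(1,2)] stateD(1)[OF \<omega>(1)] by (simp add: linear_diff)
  qed simp
  then have le1: "norm ((e - y) \<odot> (e - y)) \<le> 1" by (simp add: norm_square power_le_one)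
  have ny: "norm (y \<odot> y) = 1/4" by (simp add: norm_square y(1) power2_eq_square)
  then have "y \<odot> y \<noteq> 0" by auto
  then obtain \<omega> where \<omega>: "\<omega> \<in> states" "\<omega> e = 1" "\<omega> (y \<odot> y) = norm (y \<odot> y)"
    using corner_square_state[OF e y(2)] by metis
  have "\<omega> ((e - y) \<odot> (e - y)) = 1 + 1/4"
    using stateD(1)[OF \<omega>(1)] \<omega> y0[OF \<omega>(1,2)] y(2) e ny
    by (simp add: square_diff linear_diff linear_add linear_scale cornerD)
  then show False using state_le_norm[OF \<omega>(1), of "(e - y) \<odot> (e - y)"] le1 by simp
qed

lemma states_separate:
  assumes "\<And>\<omega>. \<omega> \<in> states \<Longrightarrow> \<omega> a = \<omega> b"
  shows "a = b"
proof -
  have "a - b = 0"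
    by (rule corner_zero[of u]) (use assms in \<open>auto simp: stateD linear_diff\<close>)
  then show ?thesis by simp
qed

text \<open>On a positive element, \<open>\<parallel>u - tp\<parallel> \<le> 1\<close> for small \<open>t > 0\<close>, and squaring gives
  \<open>\<omega>(p\<^sup>2) \<le> (2/t) \<omega>(p)\<close>.\<close>

lemma state_square_le:
  assumes p: "\<And>\<omega>. \<omega> \<in> states \<Longrightarrow> 0 \<le> \<omega> p"
  obtains C where "\<And>\<omega>. \<omega> \<in> states \<Longrightarrow> \<omega> (p \<odot> p) \<le> C * \<omega> p"
proof -
  define t where "t = 1 / (norm p + 1)"
  have t: "t > 0" by (simp add: t_def add_nonneg_pos)
  have "norm (t *\<^sub>R p) < 1" using t by (simp add: t_def divide_less_eq)
  then obtain b where b: "b \<odot> b = u - t *\<^sub>R p" by (rule unit_sqrt)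
  \<comment> \<open>As a square, \<open>u - t p\<close> attains its norm at a state, and
    \<open>\<omega> p \<ge> 0\<close> bounds that value by 1.\<close>
  have "norm (u - t *\<^sub>R p) \<le> 1"
  proof (cases "u - t *\<^sub>R p = 0")
    case False
    then obtain \<omega> where \<omega>: "\<omega> \<in> states" "\<omega> (u - t *\<^sub>R p) = norm (u - t *\<^sub>R p)"
      using corner_square_state[of u b] b by auto
    moreover have "0 \<le> t * \<omega> p" using p[OF \<omega>(1)] t by simp
    ultimately show ?thesis using stateD(1,2)[OF \<omega>(1)] by (simp add: linear_diff linear_scale)
  qed simp
  then have le1: "norm ((u - t *\<^sub>R p) \<odot> (u - t *\<^sub>R p)) \<le> 1" by (simp add: norm_square power_le_one)
  have "\<omega> (p \<odot> p) \<le> (2 / t) * \<omega> p" if \<omega>: "\<omega> \<in> states" for \<omega>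
  proof -
    have "\<omega> ((u - t *\<^sub>R p) \<odot> (u - t *\<^sub>R p)) \<le> 1"
      using state_le_norm[OF \<omega>] le1 order_trans by blast
    then have "t\<^sup>2 * \<omega> (p \<odot> p) \<le> 2 * t * \<omega> p"
      using stateD(1,2)[OF \<omega>]
      by (simp add: square_diff square_scale linear_diff linear_add linear_scale jp_linear power2_eq_square mult.assoc)
    then show ?thesis using t by (simp add: field_simps power2_eq_square)
  qed
  then show thesis using that by blast
qed

text \<open>A state with value 1 at \<open>e\<close> kills the square of \<open>u - e\<close>, hence
  satisfies \<open>\<omega> (e b) = \<omega> b\<close> for all \<open>b\<close>. So it kills the
  corner component \<open>2 e(ex) - ex\<close> of \<open>x\<close>, which is therefore 0. This
  applies to \<open>e = p\<close> and to \<open>e = u - p\<close>.\<close>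

lemma peirce_half:
  assumes p: "p \<odot> p = p"
    and x: "\<And>\<omega>. \<omega> \<in> states \<Longrightarrow> \<omega> p = 0 \<or> \<omega> p = 1 \<Longrightarrow> \<omega> x = 0"
  shows "p \<odot> x = (1/2) *\<^sub>R x"
proof -
  have *: "2 *\<^sub>R (e \<odot> (e \<odot> x)) = e \<odot> x"
    if e: "e \<odot> e = e" and x: "\<And>\<omega>. \<omega> \<in> states \<Longrightarrow> \<omega> e = 1 \<Longrightarrow> \<omega> x = 0" for e
  proof -
    have "2 *\<^sub>R (e \<odot> (e \<odot> x)) - e \<odot> x = 0"
    proof (rule corner_zero[OF e peirce_corner[OF e]])
      fix \<omega> assume \<omega>: "\<omega> \<in> states" "\<omega> e = 1"
      have "\<omega> ((u - e) \<odot> (u - e)) = 0"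
        using \<omega> stateD(1,2)[OF \<omega>(1)] e by (simp add: square_diff linear_diff linear_add linear_scale)
      then have "\<omega> ((u - e) \<odot> b) = 0" for b by (rule state_null_square[OF \<omega>(1)])
      then have "\<omega> (e \<odot> b) = \<omega> b" for b
        using stateD(1)[OF \<omega>(1)] by (simp add: jp_linear linear_diff)
      then show "\<omega> (2 *\<^sub>R (e \<odot> (e \<odot> x)) - e \<odot> x) = 0"
        using x[OF \<omega>] stateD(1)[OF \<omega>(1)] by (simp add: linear_diff linear_scale)
    qed
    then show ?thesis by simp
  qed
  have 1: "2 *\<^sub>R (p \<odot> (p \<odot> x)) = p \<odot> x" by (rule *[OF p]) (use x in auto)
  have "2 *\<^sub>R ((u - p) \<odot> ((u - p) \<odot> x)) = (u - p) \<odot> x"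
  proof (rule *)
    show "(u - p) \<odot> (u - p) = u - p" using p by (simp add: square_diff scaleR_2)
    show "\<omega> x = 0" if "\<omega> \<in> states" "\<omega> (u - p) = 1" for \<omega>
      using x[OF that(1)] that stateD(1,2)[OF that(1)] by (simp add: linear_diff)
  qed
  \<comment> \<open>Expanding the equation for \<open>u - p\<close> and replacing
    \<open>2 p(px)\<close> by \<open>px\<close> leaves \<open>x = 2 px\<close>.\<close>
  then have "x = p \<odot> x + p \<odot> x"
    using 1 by (simp add: jp_linear scaleR_2 algebra_simps)
  then have "x = 2 *\<^sub>R (p \<odot> x)" by (simp add: scaleR_2)
  then have "(1/2) *\<^sub>R x = (1/2) *\<^sub>R (2 *\<^sub>R (p \<odot> x))" by (rule arg_cong)
  then show ?thesis by simp
qed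

text \<open>Cauchy-Schwarz at \<open>\<omega>0\<close> gives \<open>c >= 1\<close>, and
  \<open>norm (p^2) = (norm p)^2\<close> gives \<open>norm p = c\<close>. A state attaining the norm
  of \<open>p^2\<close> has value \<open>c\<close> at \<open>p\<close>, so
  \<open>c <= 1\<close>.\<close>

lemma scaled_idempotent:
  assumes "p \<odot> p = c *\<^sub>R p" "\<And>\<omega>. \<omega> \<in> states \<Longrightarrow> \<omega> p \<le> 1"
    and \<omega>0: "\<omega>0 \<in> states" "\<omega>0 p = 1"
  shows "p \<odot> p = p"
proof -
  have c: "1 \<le> c"
    using state_cauchy_schwarz[OF \<omega>0(1), of p] \<omega>0 stateD(1)[OF \<omega>0(1)] assms(1) by (simp add: linear_scale)
  have "p \<noteq> 0" using \<omega>0 stateD(1)[OF \<omega>0(1)] by (auto simp: linear_0)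
  have np: "norm p = c"
    using norm_square[of p] assms(1) c \<open>p \<noteq> 0\<close> by (simp add: power2_eq_square)
  have "p \<odot> p \<noteq> 0" using assms(1) c \<open>p \<noteq> 0\<close> by simp
  then obtain \<omega> where \<omega>: "\<omega> \<in> states" "\<omega> (p \<odot> p) = norm (p \<odot> p)"
    using corner_square_state[of u p] by auto
  then have "c * \<omega> p = c * c" using stateD(1)[OF \<omega>(1)] assms(1) np c by (simp add: linear_scale)
  then have "c \<le> 1" using assms(2)[OF \<omega>(1)] c by simp
  then show ?thesis using c assms(1) by simp
qed

end

subsection \<open>Affine isomorphisms onto sets of functionals\<close>

text \<open>Splitting the coefficients into positive and negative parts makes the sum a multiple of
  a difference of two convex combinations; \<open>f\<close> preserves these and is
  injective.\<close>

lemma affine_iso_sum_eq_0: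
  assumes iso: "affine_iso f S T" and S: "convex S"
    and B: "finite B" "B \<subseteq> S" and c: "(\<Sum>b\<in>B. c b) = 0"
  shows "(\<Sum>b\<in>B. c b *\<^sub>R b) = 0 \<longleftrightarrow> (\<forall>a. (\<Sum>b\<in>B. c b * f b a) = 0)"
proof -
  have aff: "f (t *\<^sub>R x + (1 - t) *\<^sub>R y) = (\<lambda>a. t * f x a + (1 - t) * f y a)"
    if "x \<in> S" "y \<in> S" "0 \<le> t" "t \<le> 1" for x y t
    using iso that unfolding affine_iso_def by blast
  have aff': "f (s *\<^sub>R x + t *\<^sub>R y) a = s * f x a + t * f y a"
    if "x \<in> S" "y \<in> S" "0 \<le> s" "0 \<le> t" "s + t = 1" for x y s t a
  proof -
    have "t = 1 - s" using that by simp
    moreover from this have "s \<le> 1" using that(4) by simp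
    ultimately show ?thesis using aff[OF that(1,2,3)] by simp
  qed
  \<comment> \<open>Jensen's inequality for the value of \<open>f\<close> at \<open>a\<close> and
    for its negative gives the two directions.\<close>
  have comb: "f (\<Sum>b\<in>B. w b *\<^sub>R b) a = (\<Sum>b\<in>B. w b * f b a)"
    if w: "\<And>b. b \<in> B \<Longrightarrow> w b \<ge> 0" "(\<Sum>b\<in>B. w b) = 1" for w a
  proof (rule antisym)
    have B0: "B \<noteq> {}" using w(2) by auto
    have "convex_on S (\<lambda>x. f x a)" using S by (auto simp: convex_on_def aff')
    then show "f (\<Sum>b\<in>B. w b *\<^sub>R b) a \<le> (\<Sum>b\<in>B. w b * f b a)"
      using convex_on_sum[OF B(1) B0, of S "\<lambda>x. f x a" w "\<lambda>b. b"] w B(2) by auto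
    have "convex_on S (\<lambda>x. - f x a)" using S by (auto simp: convex_on_def aff')
    then have "- f (\<Sum>b\<in>B. w b *\<^sub>R b) a \<le> (\<Sum>b\<in>B. w b * - f b a)"
      using convex_on_sum[OF B(1) B0, of S "\<lambda>x. - f x a" w "\<lambda>b. b"] w B(2) by auto
    then show "(\<Sum>b\<in>B. w b * f b a) \<le> f (\<Sum>b\<in>B. w b *\<^sub>R b) a" by (simp add: sum_negf)
  qed
  \<comment> \<open>The total positive weight. As the coefficients sum to 0 it is also the total
    negative weight, so it normalizes both parts.\<close>
  define N where "N = (\<Sum>b\<in>B. max (c b) 0)"
  have N': "N = (\<Sum>b\<in>B. max (- c b) 0)"
  proof -
    have "N - (\<Sum>b\<in>B. max (- c b) 0) = (\<Sum>b\<in>B. c b)"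
      unfolding N_def sum_subtractf[symmetric] by (rule sum.cong) auto
    then show ?thesis using c by simp
  qed
  show ?thesis
  proof (cases "N = 0")
    case True
    have "max (c b) 0 = 0" "max (- c b) 0 = 0" if "b \<in> B" for b
      using True N_def N' B(1) that sum_nonneg_eq_0_iff[of B "\<lambda>b. max (c b) 0"]
        sum_nonneg_eq_0_iff[of B "\<lambda>b. max (- c b) 0"] by auto
    then have "c b = 0" if "b \<in> B" for b using that by (metis max.absorb_iff2 max_def neg_le_0_iff_le antisym)
    then show ?thesis by simp
  next
    case False
    then have N: "N > 0" unfolding N_def by (metis (no_types, lifting) max.cobounded2 order_le_less sum_nonneg)
    define v where "v b = max (c b) 0 / N" for b
    define w where "w b = max (- c b) 0 / N" for b
    have vw: "\<And>b. v b \<ge> 0" "\<And>b. w b \<ge> 0" using N by (auto simp: v_def w_def)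
    have s: "(\<Sum>b\<in>B. v b) = 1" "(\<Sum>b\<in>B. w b) = 1"
      using N N' by (simp_all add: v_def w_def N_def flip: sum_divide_distrib)
    have cvw: "c b = N * (v b - w b)" for b using N by (auto simp: v_def w_def max_def right_diff_distrib)
    let ?x = "\<Sum>b\<in>B. v b *\<^sub>R b" and ?y = "\<Sum>b\<in>B. w b *\<^sub>R b"
    have S': "?x \<in> S" "?y \<in> S" using B vw s by (auto intro!: convex_sum[OF _ S])
    have "(\<Sum>b\<in>B. c b *\<^sub>R b) = N *\<^sub>R (?x - ?y)"
      by (simp add: cvw scaleR_sum_right scaleR_left_diff_distrib sum_subtractf scaleR_diff_right algebra_simps)
    then have "(\<Sum>b\<in>B. c b *\<^sub>R b) = 0 \<longleftrightarrow> ?x = ?y" using N by simp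
    also have "\<dots> \<longleftrightarrow> f ?x = f ?y"
      using iso S' by (auto simp: affine_iso_def bij_betw_def inj_on_def)
    also have "\<dots> \<longleftrightarrow> (\<forall>a. f ?x a = f ?y a)" by (rule fun_eq_iff)
    also have "\<dots> \<longleftrightarrow> (\<forall>a. N * (f ?x a - f ?y a) = 0)" using N by simp
    also have "\<dots> \<longleftrightarrow> (\<forall>a. (\<Sum>b\<in>B. c b * f b a) = 0)"
      using vw s by (simp add: comb cvw sum_distrib_left sum_subtractf[symmetric] algebra_simps)
    finally show ?thesis .
  qed
qed

text \<open>Expresses a relation between \<open>x\<close> and \<open>B\<close> as one sum over
  \<open>insert x B\<close>. The conditionals in the coefficients also cover the case
  \<open>x \<in> B\<close>.\<close>

lemma sum_insert_coeff:
  fixes h :: "'b \<Rightarrow> 'c::real_vector"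
  assumes fin: "finite B"
  shows "(\<Sum>b\<in>insert x B. ((if b \<in> B then r b else 0) - (if b = x then 1 else 0)) *\<^sub>R h b)
    = (\<Sum>b\<in>B. r b *\<^sub>R h b) - h x"
proof -
  have "(\<Sum>b\<in>insert x B. ((if b \<in> B then r b else 0) - (if b = x then 1 else 0)) *\<^sub>R h b)
      = (\<Sum>b\<in>insert x B. (if b \<in> B then r b else 0) *\<^sub>R h b) - (\<Sum>b\<in>insert x B. if b = x then h b else 0)"
    unfolding sum_subtractf[symmetric] by (rule sum.cong) (auto simp: scaleR_left_diff_distrib)
  also have "(\<Sum>b\<in>insert x B. (if b \<in> B then r b else 0) *\<^sub>R h b) = (\<Sum>b\<in>B. r b *\<^sub>R h b)"
    using fin by (intro sum.mono_neutral_cong_right) auto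
  finally show ?thesis using fin by simp
qed

text \<open>A basis \<open>B\<close> of the span is chosen inside \<open>S\<close>. Since
  \<open>\<tau>\<close> is 1 on \<open>S\<close>, the expansion of a point of \<open>S\<close> in
  \<open>B\<close> has coefficients summing to 1, so \<open>f\<close> preserves it and agreement on
  \<open>B\<close> suffices.\<close>

lemma affine_iso_linear_extension:
  fixes S :: "'b::euclidean_space set" and f :: "'b \<Rightarrow> 'a::real_vector \<Rightarrow> real"
    and \<tau> :: "'b \<Rightarrow> real"
  assumes iso: "affine_iso f S T" and S: "convex S"
    and T: "\<And>\<omega>. \<omega> \<in> T \<Longrightarrow> linear \<omega> \<and> \<omega> u = 1"
    and \<tau>: "linear \<tau>" "\<And>x. x \<in> S \<Longrightarrow> \<tau> x = 1"
  shows "\<exists>g. linear g \<and> (\<forall>x\<in>S. f x a = g x)"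
    and "linear g \<Longrightarrow> \<exists>a. \<forall>x\<in>S. f x a = g x"
proof -
  obtain B where B: "B \<subseteq> S" "independent B" "S \<subseteq> span B"
    using basis_exists[of S] by metis
  have fin: "finite B" using B(2) by (rule independent_imp_finite)
  have ind: "\<forall>b\<in>B. c b = 0" if "(\<Sum>b\<in>B. c b *\<^sub>R b) = 0" for c
    using B(2) fin that by (simp add: independent_explicit)
  have fT: "f b \<in> T" if "b \<in> S" for b
    using iso that by (auto simp: affine_iso_def bij_betw_def)
  have ext: "f x a = g x" if x: "x \<in> S" and g: "linear g" "\<And>b. b \<in> B \<Longrightarrow> f b a = g b" for x a g
  proof -
    obtain r where r: "x = (\<Sum>b\<in>B. r b *\<^sub>R b)"
      using x B(3) span_finite[OF fin] by auto
    have lin: "h x = (\<Sum>b\<in>B. r b * h b)" if "linear h" for h :: "'b \<Rightarrow> real"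
      using that by (simp add: r linear_sum linear_scale)
    define c where "c b = (if b \<in> B then r b else 0) - (if b = x then 1 else 0)" for b
    note sums = sum_insert_coeff[OF fin, where x = x and r = r, folded c_def]
    have "(\<Sum>b\<in>B. r b) = 1"
      using lin[OF \<tau>(1)] \<tau>(2) x B(1) by (simp add: subset_iff)
    then have "(\<Sum>b\<in>insert x B. c b) = 0" using sums[of "\<lambda>_. 1::real"] by simp
    then have "(\<Sum>b\<in>insert x B. c b *\<^sub>R b) = 0 \<longleftrightarrow> (\<forall>a. (\<Sum>b\<in>insert x B. c b * f b a) = 0)"
      using x B(1) fin by (intro affine_iso_sum_eq_0[OF iso S]) auto
    moreover have "(\<Sum>b\<in>insert x B. c b *\<^sub>R b) = 0" using sums[of "\<lambda>b. b"] r by simp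
    ultimately have "(\<Sum>b\<in>insert x B. c b * f b a) = 0" by blast
    then have "f x a = (\<Sum>b\<in>B. r b * f b a)" using sums[of "\<lambda>b. f b a"] by simp
    also have "\<dots> = g x" unfolding lin[OF g(1)] by (rule sum.cong) (simp_all add: g(2))
    finally show ?thesis .
  qed
  obtain g' where "linear g'" "\<And>b. b \<in> B \<Longrightarrow> g' b = f b a"
    using linear_independent_extend[OF B(2), of "\<lambda>b. f b a"] by blast
  then show "\<exists>g. linear g \<and> (\<forall>x\<in>S. f x a = g x)"
    using ext[of _ g' a] by auto
  assume g: "linear g"
  \<comment> \<open>\<open>F a\<close> records the values \<open>f b a\<close> as coordinates in the
    basis \<open>B\<close>, so the claim reduces to \<open>F\<close> mapping onto
    \<open>span B\<close>.\<close>
  define F where "F a = (\<Sum>b\<in>B. f b a *\<^sub>R b)" for a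
  have fl: "linear (f b)" "f b u = 1" if "b \<in> B" for b using T fT B(1) that by blast+
  have "linear F" unfolding F_def
    by (intro linear_compose_sum ballI linearI)
       (use fl in \<open>simp_all add: linear_add linear_scale scaleR_left_distrib\<close>)
  then have sF: "subspace (range F)" by (intro linear_subspace_image subspace_UNIV)
  have sub: "range F \<subseteq> span B" by (auto simp: F_def intro: span_sum span_scale span_base)
  have "\<not> span (range F) \<subset> span B"
  proof
    assume "span (range F) \<subset> span B"
    then obtain x where x: "x \<noteq> 0" "x \<in> span B" "\<And>y. y \<in> span (range F) \<Longrightarrow> orthogonal x y"
      using orthogonal_to_subspace_exists_gen by metis
    \<comment> \<open>Orthogonality to the range is a relation among the functionals
      \<open>f b\<close>. At \<open>a = u\<close> it shows that the coefficients sum to 0, so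
      injectivity of \<open>f\<close> turns it into a relation among the independent vectors of
      \<open>B\<close>.\<close>
    have 0: "(\<Sum>b\<in>B. (x \<bullet> b) * f b a) = 0" for a
      using x(3)[OF span_base[OF rangeI[of F a]]]
      by (simp add: orthogonal_def F_def inner_sum_right mult.commute)
    have "(\<Sum>b\<in>B. x \<bullet> b) = 0" using 0[of u] fl(2) by simp
    then have "(\<Sum>b\<in>B. (x \<bullet> b) *\<^sub>R b) = 0"
      using 0 affine_iso_sum_eq_0[OF iso S fin B(1)] by blast
    then have "\<forall>b\<in>B. x \<bullet> b = 0" by (rule ind)
    then have "orthogonal x x" using x(2) by (intro orthogonal_to_span[of x B]) (auto simp: orthogonal_def)
    then show False using x(1) by (simp add: orthogonal_def)
  qed
  moreover have "span (range F) = range F" using sF by (simp add: span_eq_iff)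
  ultimately have "range F = span B" using sub by auto
  moreover have "(\<Sum>b\<in>B. g b *\<^sub>R b) \<in> span B" by (intro span_sum span_scale span_base)
  ultimately obtain a where "F a = (\<Sum>b\<in>B. g b *\<^sub>R b)" by (metis imageE)
  then have "(\<Sum>b\<in>B. (f b a - g b) *\<^sub>R b) = 0"
    by (simp add: F_def scaleR_left_diff_distrib sum_subtractf)
  then have "\<forall>b\<in>B. f b a - g b = 0" by (rule ind)
  then show "\<exists>a. \<forall>x\<in>S. f x a = g x" using ext g by (metis eq_iff_diff_eq_0)
qed

subsection \<open>Functionals on separable states\<close>

abbreviation product_state :: "complex ^ 2 \<Rightarrow> complex ^ 2 \<Rightarrow> op22" where
  "product_state v w \<equiv> tensor_op (outer v v) (outer w w)"

lemma product_state_entry: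
  "product_state v w $ (i, j) $ (k, l) = v $ i * cnj (v $ k) * (w $ j * cnj (w $ l))"
  by (simp add: tensor_op_def outer_def)

lemma product_state_diag:
  "Re (product_state v w $ (i, j) $ (i, j)) = (cmod (v $ i))\<^sup>2 * (cmod (w $ j))\<^sup>2"
  by (simp add: product_state_entry complex_norm_square[symmetric] flip: of_real_power of_real_mult)

lemma product_state_separable:
  assumes "norm v = 1" "norm w = 1"
  shows "product_state v w \<in> separable_states"
  unfolding separable_states_def rank_one_proj_def using assms by (intro hull_inc) blast

lemma separable_induct:
  assumes "\<rho> \<in> separable_states" "convex {\<rho>. P \<rho>}"
    and "\<And>v w. norm v = 1 \<Longrightarrow> norm w = 1 \<Longrightarrow> P (product_state v w)"
  shows "P \<rho>"
proof -
  have "separable_states \<subseteq> {\<rho>. P \<rho>}"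
    unfolding separable_states_def rank_one_proj_def using assms(2,3) by (intro hull_minimal) auto
  then show ?thesis using assms(1) by auto
qed

lemma linear_entry: "linear (\<lambda>\<rho>::op22. Re (\<rho> $ p $ q))"
  by (intro linearI) auto

lemma linear_tensor_left: "linear (\<lambda>X. tensor_op X Y)"
  by (intro linearI) (auto simp: tensor_op_def vec_eq_iff algebra_simps)

lemma linear_tensor_right: "linear (tensor_op X)"
  by (intro linearI) (auto simp: tensor_op_def vec_eq_iff algebra_simps)

lemma outer_scale: "outer (r *\<^sub>R v) (r *\<^sub>R v) = r\<^sup>2 *\<^sub>R outer v v"
  by (simp add: outer_def vec_eq_iff power2_eq_square)

lemma norm_vec2: "(norm (v :: complex ^ 2))\<^sup>2 = (cmod (v $ 1))\<^sup>2 + (cmod (v $ 2))\<^sup>2"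
  by (simp add: norm_vec_def L2_set_def sum_2)

lemma norm_axis_one: "norm (axis i 1 :: complex ^ 2) = 1"
proof -
  have "(norm (axis i 1 :: complex ^ 2))\<^sup>2 = 1\<^sup>2"
    unfolding norm_vec2 using exhaust_2[of i] by (auto simp: axis_def)
  then show ?thesis by (rule power2_eq_imp_eq) auto
qed

text \<open>The vectors obtained from \<open>v\<close> by multiplying its \<open>i\<close>-th entry with a real \<open>t\<close>
  make \<open>h\<close> a nonnegative quadratic polynomial in \<open>t\<close> without constant term.\<close>

lemma dominated_functional_outer:
  assumes h: "linear h" and b: "\<And>v. 0 \<le> h (outer v v) \<and> h (outer v v) \<le> C * (cmod (v $ i))\<^sup>2"
  shows "h (outer v v) = (cmod (v $ i))\<^sup>2 * h (outer (axis i 1) (axis i 1))"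
proof -
  define V :: "real \<Rightarrow> complex ^ 2" where "V t = (\<chi> k. if k = i then of_real t * v $ k else v $ k)" for t
  let ?E = "(cmod (v $ i))\<^sup>2 *\<^sub>R outer (axis i 1) (axis i 1)"
  let ?O = "outer (V 0) (V 0)"
  define D where "D = outer v v - ?E - ?O"
  have V: "outer (V t) (V t) = t\<^sup>2 *\<^sub>R ?E + t *\<^sub>R D + ?O" for t
    unfolding vec_eq_iff D_def
    by (auto simp: outer_def V_def axis_def complex_eq_iff cmod_power2)
       (simp_all add: power2_eq_square algebra_simps)
  have hV: "h (outer (V t) (V t)) = t\<^sup>2 * h ?E + t * h D + h ?O" for t
    by (subst V) (simp only: linear_add[OF h] linear_scale[OF h] real_scaleR_def)
  have O: "h ?O = 0" using b[of "V 0"] by (simp add: V_def)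
  have pos: "0 \<le> t\<^sup>2 * h ?E + t * h D" for t using b[of "V t"] hV[of t] O by simp
  have "h D = 0"
  proof (rule ccontr)
    assume D: "h D \<noteq> 0"
    \<comment> \<open>At \<open>t = - h D / s\<close> the quadratic has the value
      \<open>(h D / s)^2 (h ?E - s)\<close>, negative because \<open>s > h ?E\<close>.\<close>
    define s where "s = \<bar>h ?E\<bar> + 1"
    have s: "s > 0" "h ?E < s" by (auto simp: s_def)
    have "0 \<le> (- h D / s)\<^sup>2 * h ?E + (- h D / s) * h D" by (rule pos)
    also have "\<dots> = (h D)\<^sup>2 / s\<^sup>2 * (h ?E - s)" using s by (simp add: field_simps power2_eq_square)
    also have "\<dots> < 0" using s D by (intro mult_pos_neg) auto
    finally show False by simp
  qed
  moreover have "h D = h (outer v v) - h ?E - h ?O" unfolding D_def using h by (simp add: linear_diff)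
  ultimately show ?thesis using O h by (simp add: linear_scale)
qed

text \<open>On product states the bound factorizes, so the one-factor result applies to each tensor
  factor with the other held fixed; linearity then passes to convex combinations.\<close>

lemma dominated_functional_separable:
  assumes g: "linear g"
    and b: "\<And>\<rho>. \<rho> \<in> separable_states \<Longrightarrow> 0 \<le> g \<rho> \<and> g \<rho> \<le> C * Re (\<rho> $ (i, j) $ (i, j))"
  obtains c where "\<And>\<rho>. \<rho> \<in> separable_states \<Longrightarrow> g \<rho> = c * Re (\<rho> $ (i, j) $ (i, j))"
proof -
  \<comment> \<open>The bound is extended by homogeneity from unit vectors to all vectors, since the
    one-factor result rescales single entries and leaves the unit sphere.\<close>
  have bound: "0 \<le> g (product_state v w) \<and>
      g (product_state v w) \<le> C * ((cmod (v $ i))\<^sup>2 * (cmod (w $ j))\<^sup>2)" for v w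
  proof (cases "v = 0 \<or> w = 0")
    case True
    then have "product_state v w = 0" by (auto simp: vec_eq_iff tensor_op_def outer_def)
    then show ?thesis using True g by (auto simp: linear_0)
  next
    case False
    define v' w' where "v' = v /\<^sub>R norm v" and "w' = w /\<^sub>R norm w"
    define k where "k = (norm v)\<^sup>2 * (norm w)\<^sup>2"
    have k: "k > 0" using False by (simp add: k_def)
    have n: "norm v' = 1" "norm w' = 1" using False by (auto simp: v'_def w'_def)
    have vw: "v = norm v *\<^sub>R v'" "w = norm w *\<^sub>R w'" using False by (auto simp: v'_def w'_def)
    have eq: "product_state v w = k *\<^sub>R product_state v' w'"
      by (subst vw(1), subst (2) vw(1), subst vw(2), subst (2) vw(2))
        (simp only: outer_scale linear_scale[OF linear_tensor_left] linear_scale[OF linear_tensor_right] k_def scaleR_scaleR mult.commute)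
    have "0 \<le> g (product_state v' w')"
      "g (product_state v' w') \<le> C * Re (product_state v' w' $ (i, j) $ (i, j))"
      using b[OF product_state_separable[OF n]] by auto
    then have "0 \<le> k * g (product_state v' w')"
      "k * g (product_state v' w') \<le> k * (C * Re (product_state v' w' $ (i, j) $ (i, j)))"
      using k by (auto intro: mult_left_mono)
    then have "0 \<le> g (product_state v w)"
      "g (product_state v w) \<le> C * Re (product_state v w $ (i, j) $ (i, j))"
      unfolding eq using g by (simp_all add: linear_scale mult.left_commute)
    then show ?thesis by (simp only: product_state_diag)
  qed
  define c where "c = g (product_state (axis i 1) (axis j 1))"
  have prod: "g (product_state v w) = c * ((cmod (v $ i))\<^sup>2 * (cmod (w $ j))\<^sup>2)" for v w
  proof -
    have "g (product_state v w) = (cmod (v $ i))\<^sup>2 * g (product_state (axis i 1) w)"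
      using bound by (intro dominated_functional_outer[where C = "C * (cmod (w $ j))\<^sup>2"]
          linear_compose[OF linear_tensor_left g, unfolded o_def]) (simp_all add: mult_ac)
    also have "g (product_state (axis i 1) w) = (cmod (w $ j))\<^sup>2 * c"
      unfolding c_def using bound[of "axis i 1"]
      by (intro dominated_functional_outer[where C = C]
          linear_compose[OF linear_tensor_right g, unfolded o_def]) simp_all
    finally show ?thesis by simp
  qed
  have "g \<rho> = c * Re (\<rho> $ (i, j) $ (i, j))" if "\<rho> \<in> separable_states" for \<rho>
  proof (rule separable_induct[OF that])
    show "convex {\<rho>. g \<rho> = c * Re (\<rho> $ (i, j) $ (i, j))}"
      using g by (auto simp: convex_def linear_add linear_scale algebra_simps)
    show "g (product_state v w) = c * Re (product_state v w $ (i, j) $ (i, j))" for v w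
      by (simp only: prod product_state_diag)
  qed
  then show thesis using that by blast
qed

section \<open>Diagonal and off-diagonal entries of separable states\<close>

lemma separable_diag_nonneg:
  assumes "\<rho> \<in> separable_states"
  shows "0 \<le> Re (\<rho> $ (i, j) $ (i, j))"
  using assms
proof (rule separable_induct)
  show "convex {\<rho>::op22. 0 \<le> Re (\<rho> $ (i, j) $ (i, j))}" by (auto simp: convex_def)
  show "0 \<le> Re (product_state v w $ (i, j) $ (i, j))" for v w by (simp add: product_state_diag)
qed

lemma separable_trace:
  assumes "\<rho> \<in> separable_states"
  shows "(\<Sum>i\<in>UNIV. \<Sum>j\<in>UNIV. Re (\<rho> $ (i, j) $ (i, j))) = 1"
  using assms
proof (rule separable_induct)
  show "convex {\<rho>::op22. (\<Sum>i\<in>UNIV. \<Sum>j\<in>UNIV. Re (\<rho> $ (i, j) $ (i, j))) = 1}"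
    by (auto simp: convex_def sum.distrib simp flip: sum_distrib_left)
  show "(\<Sum>i\<in>UNIV. \<Sum>j\<in>UNIV. Re (product_state v w $ (i, j) $ (i, j))) = 1"
    if "norm v = 1" "norm w = 1" for v w
    using norm_vec2[of v] norm_vec2[of w] that
    by (simp add: product_state_diag sum_2 flip: distrib_left distrib_right)
qed

text \<open>For a product state the squared modulus of the entry is the product of all
  \<open>|v_k|^2\<close> and \<open>|w_k|^2\<close>, each at most 1, so any
  \<open>|v_i|^2 |w_j|^2\<close> bounds it. Convexity of the square extends this to mixtures.
  Entangled states can violate it: for the Bell vector
  \<open>(e_1 \<otimes> e_1 + e_2 \<otimes> e_2) / sqrt 2\<close> the entry is 1/2, but two diagonal
  entries are 0.\<close>

lemma separable_offdiag_le:
  assumes "\<rho> \<in> separable_states"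
  shows "(Re (\<rho> $ (1, 1) $ (2, 2)))\<^sup>2 \<le> Re (\<rho> $ (i, j) $ (i, j))"
  using assms
proof (rule separable_induct)
  show "convex {\<rho>::op22. (Re (\<rho> $ (1, 1) $ (2, 2)))\<^sup>2 \<le> Re (\<rho> $ (i, j) $ (i, j))}"
  proof (rule convexI, safe)
    fix x y :: op22 and s t :: real
    let ?l = "\<lambda>\<rho>::op22. Re (\<rho> $ (1, 1) $ (2, 2))" and ?d = "\<lambda>\<rho>::op22. Re (\<rho> $ (i, j) $ (i, j))"
    assume *: "(?l x)\<^sup>2 \<le> ?d x" "(?l y)\<^sup>2 \<le> ?d y" "0 \<le> s" "0 \<le> t" "s + t = 1"
    have "s * a\<^sup>2 + t * b\<^sup>2 - (s * a + t * b)\<^sup>2 = s * t * (a - b)\<^sup>2" for a b :: real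
    proof -
      have s: "s = 1 - t" using *(5) by simp
      show ?thesis unfolding s by (simp add: power2_eq_square algebra_simps)
    qed
    moreover have "0 \<le> s * t * (?l x - ?l y)\<^sup>2" using *(3,4) by simp
    ultimately have "(s * ?l x + t * ?l y)\<^sup>2 \<le> s * (?l x)\<^sup>2 + t * (?l y)\<^sup>2"
      by (metis diff_ge_0_iff_ge)
    also have "\<dots> \<le> s * ?d x + t * ?d y" using * by (intro add_mono mult_left_mono)
    finally show "(?l (s *\<^sub>R x + t *\<^sub>R y))\<^sup>2 \<le> ?d (s *\<^sub>R x + t *\<^sub>R y)" by simp
  qed
  fix v w :: "complex ^ 2" assume n: "norm v = 1" "norm w = 1"
  have le1: "(cmod (v $ k))\<^sup>2 \<le> 1" "(cmod (w $ k))\<^sup>2 \<le> 1" for k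
    using Finite_Cartesian_Product.norm_nth_le[of v k] Finite_Cartesian_Product.norm_nth_le[of w k] n by (simp_all add: power_le_one)
  have two: "x 1 * x 2 \<le> x k" if "\<And>k. 0 \<le> x k \<and> x k \<le> 1" for x :: "2 \<Rightarrow> real" and k
    using that[of 1] that[of 2] exhaust_2[of k] by (auto simp: mult_left_le mult_left_le_one_le)
  have "(Re (product_state v w $ (1, 1) $ (2, 2)))\<^sup>2 \<le> (cmod (product_state v w $ (1, 1) $ (2, 2)))\<^sup>2"
    by (metis abs_Re_le_cmod abs_norm_cancel abs_le_square_iff)
  also have "\<dots> = ((cmod (v $ 1))\<^sup>2 * (cmod (v $ 2))\<^sup>2) * ((cmod (w $ 1))\<^sup>2 * (cmod (w $ 2))\<^sup>2)"
    by (simp add: product_state_entry norm_mult power_mult_distrib)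
  also have "\<dots> \<le> (cmod (v $ i))\<^sup>2 * (cmod (w $ j))\<^sup>2"
    using le1 by (intro mult_mono two[of "\<lambda>k. (cmod (v $ k))\<^sup>2"] two[of "\<lambda>k. (cmod (w $ k))\<^sup>2"]) auto
  finally show "(Re (product_state v w $ (1, 1) $ (2, 2)))\<^sup>2 \<le> Re (product_state v w $ (i, j) $ (i, j))"
    by (simp only: product_state_diag)
qed

text \<open>If the entry at \<open>(i, j)\<close> is 1, the one at \<open>(k, l)\<close> is not
  positive, and \<open>separable_offdiag_le\<close> can be applied there. With nonnegativity it also
  bounds each diagonal entry by 1.\<close>

lemma separable_diag_le_one_minus:
  assumes "\<rho> \<in> separable_states"
  obtains k l where "Re (\<rho> $ (k, l) $ (k, l)) \<le> 1 - Re (\<rho> $ (i, j) $ (i, j))"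
proof -
  let ?d = "\<lambda>i j. Re (\<rho> $ (i, j) $ (i, j))"
  have nonneg: "0 \<le> ?d k l" for k l by (rule separable_diag_nonneg[OF assms])
  have "?d 1 1 + ?d 1 2 + (?d 2 1 + ?d 2 2) = 1" using separable_trace[OF assms] by (simp add: sum_2)
  \<comment> \<open>In the index type \<open>2\<close>, \<open>3 - i\<close> is the index different
    from \<open>i\<close>.\<close>
  then have "?d (3 - i) j \<le> 1 - ?d i j"
    using nonneg[of 1 1] nonneg[of 1 2] nonneg[of 2 1] nonneg[of 2 2] exhaust_2[of i] exhaust_2[of j]
    by auto
  then show thesis by (rule that)
qed

section \<open>Contradiction from a hypothetical isomorphism\<close>

theorem theorem3:
  fixes jp :: "'a::banach \<Rightarrow> 'a \<Rightarrow> 'a" and u :: 'a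
  assumes "JB_algebra jp u"
  shows "\<not> (\<exists>f. affine_iso f separable_states (JB_states jp u))"
proof
  interpret jb_algebra jp u by (unfold_locales) (rule assms)
  let ?S = "separable_states"
  assume "\<exists>f. affine_iso f ?S states"
  then obtain f where iso: "affine_iso f ?S states" by blast
  define d where "d i j \<rho> = Re (\<rho> $ (i, j) $ (i, j))" for i j :: 2 and \<rho> :: op22
  have dlin: "linear (d i j)" for i j unfolding d_def by (rule linear_entry)
  have S: "convex ?S" by (simp add: separable_states_def)
  have \<tau>: "linear (\<lambda>\<rho>. \<Sum>i\<in>UNIV. \<Sum>j\<in>UNIV. d i j \<rho>)" "\<And>\<rho>. \<rho> \<in> ?S \<Longrightarrow> (\<Sum>i\<in>UNIV. \<Sum>j\<in>UNIV. d i j \<rho>) = 1"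
    using separable_trace by (auto simp: d_def intro!: linear_compose_sum linear_entry)
  have T: "linear \<omega> \<and> \<omega> u = 1" if "\<omega> \<in> states" for \<omega> using stateD[OF that] by blast
  \<comment> \<open>The trace serves as the linear functional with value 1 on the separable
    states.\<close>
  note ext = affine_iso_linear_extension[OF iso S T \<tau>]
  have st: "f \<rho> \<in> states" if "\<rho> \<in> ?S" for \<rho>
    using iso that by (auto simp: affine_iso_def bij_betw_def)
  have stE: "\<exists>\<rho>\<in>?S. \<omega> = f \<rho>" if "\<omega> \<in> states" for \<omega>
    using iso that by (auto simp: affine_iso_def bij_betw_def)
  have fl: "linear (f \<rho>)" "f \<rho> u = 1" if "\<rho> \<in> ?S" for \<rho> using stateD(1,2)[OF st[OF that]] .
  have "\<exists>a. \<forall>\<rho>\<in>?S. f \<rho> a = d i j \<rho>" for i j by (rule ext(2)[OF _ _ dlin])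
  then obtain p where p: "\<And>i j \<rho>. \<rho> \<in> ?S \<Longrightarrow> f \<rho> (p i j) = d i j \<rho>" by metis
  have "\<exists>a. \<forall>\<rho>\<in>?S. f \<rho> a = Re (\<rho> $ (1, 1) $ (2, 2))" by (rule ext(2)[OF _ _ linear_entry])
  then obtain x where x: "\<And>\<rho>. \<rho> \<in> ?S \<Longrightarrow> f \<rho> x = Re (\<rho> $ (1, 1) $ (2, 2))" by blast
  have idem: "jp (p i j) (p i j) = p i j" for i j
  proof -
    have "0 \<le> \<omega> (p i j)" if "\<omega> \<in> states" for \<omega>
      using stE[OF that] p separable_diag_nonneg by (auto simp: d_def)
    then obtain C where C: "\<And>\<omega>. \<omega> \<in> states \<Longrightarrow> \<omega> (jp (p i j) (p i j)) \<le> C * \<omega> (p i j)"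
      using state_square_le by metis
    have "\<exists>g. linear g \<and> (\<forall>\<rho>\<in>?S. f \<rho> (jp (p i j) (p i j)) = g \<rho>)" by (rule ext(1))
    then obtain g where g: "linear g" "\<And>\<rho>. \<rho> \<in> ?S \<Longrightarrow> f \<rho> (jp (p i j) (p i j)) = g \<rho>" by blast
    have "0 \<le> g \<rho> \<and> g \<rho> \<le> C * Re (\<rho> $ (i, j) $ (i, j))" if "\<rho> \<in> ?S" for \<rho>
      using C[OF st[OF that]] stateD(3)[OF st[OF that], of "p i j"] by (simp add: g p that d_def)
    then obtain c where c: "\<And>\<rho>. \<rho> \<in> ?S \<Longrightarrow> g \<rho> = c * Re (\<rho> $ (i, j) $ (i, j))"
      using dominated_functional_separable[OF g(1)] by metis
    show ?thesis
    proof (rule scaled_idempotent)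
      show "jp (p i j) (p i j) = c *\<^sub>R p i j"
      proof (rule states_separate)
        fix \<omega> assume "\<omega> \<in> states"
        then obtain \<rho> where "\<rho> \<in> ?S" "\<omega> = f \<rho>" using stE by blast
        then show "\<omega> (jp (p i j) (p i j)) = \<omega> (c *\<^sub>R p i j)"
          using fl(1) by (simp add: linear_scale g p c d_def)
      qed
      show "\<omega> (p i j) \<le> 1" if "\<omega> \<in> states" for \<omega>
      proof -
        obtain \<rho> where \<rho>: "\<rho> \<in> ?S" "\<omega> = f \<rho>" using stE[OF \<open>\<omega> \<in> states\<close>] by blast
        obtain k l where "Re (\<rho> $ (k, l) $ (k, l)) \<le> 1 - Re (\<rho> $ (i, j) $ (i, j))"
          using \<rho>(1) by (rule separable_diag_le_one_minus)
        then show ?thesis using separable_diag_nonneg[OF \<rho>(1), of k l] by (simp add: \<rho> p d_def)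
      qed
      \<comment> \<open>The basis state at \<open>(i, j)\<close> is the state with value 1 that
        \<open>scaled_idempotent\<close> asks for.\<close>
      have "product_state (axis i 1) (axis j 1) \<in> ?S" by (intro product_state_separable norm_axis_one)
      then show "f (product_state (axis i 1) (axis j 1)) \<in> states"
        "f (product_state (axis i 1) (axis j 1)) (p i j) = 1"
        by (simp_all add: st p d_def product_state_diag)
    qed
  qed
  have half: "jp (p i j) x = (1/2) *\<^sub>R x" for i j
  proof (rule peirce_half[OF idem])
    fix \<omega> assume "\<omega> \<in> states" and 01: "\<omega> (p i j) = 0 \<or> \<omega> (p i j) = 1"
    then obtain \<rho> where \<rho>: "\<rho> \<in> ?S" "\<omega> = f \<rho>" using stE by blast
    obtain k l where kl: "Re (\<rho> $ (k, l) $ (k, l)) \<le> 1 - Re (\<rho> $ (i, j) $ (i, j))"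
      using \<rho>(1) by (rule separable_diag_le_one_minus)
    have "Re (\<rho> $ (i, j) $ (i, j)) = 0 \<or> Re (\<rho> $ (i, j) $ (i, j)) = 1"
      using 01 by (simp add: \<rho> p d_def)
    \<comment> \<open>If the diagonal entry is 0, the bound at \<open>(i, j)\<close> applies; if it
      is 1, the one at \<open>(k, l)\<close>.\<close>
    then have "(Re (\<rho> $ (1, 1) $ (2, 2)))\<^sup>2 \<le> 0"
      using kl separable_offdiag_le[OF \<rho>(1), of i j] separable_offdiag_le[OF \<rho>(1), of k l] by argo
    then show "\<omega> x = 0" by (simp add: \<rho> x)
  qed
  have "(\<Sum>i\<in>UNIV. \<Sum>j\<in>UNIV. p i j) = u"
  proof (rule states_separate)
    fix \<omega> assume "\<omega> \<in> states"
    then obtain \<rho> where "\<rho> \<in> ?S" "\<omega> = f \<rho>" using stE by blast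
    then show "\<omega> (\<Sum>i\<in>UNIV. \<Sum>j\<in>UNIV. p i j) = \<omega> u"
      using fl \<tau>(2) by (simp add: linear_sum p)
  qed
  then have "x = (\<Sum>i\<in>UNIV. \<Sum>j\<in>UNIV. jp (p i j) x)"
    by (simp add: sum_2 flip: jp_add_left)
  then have "x = x + x" by (simp add: half sum_2 flip: scaleR_left_distrib)
  then have "x = 0" by simp
  \<comment> \<open>All entries of \<open>product_state v v\<close> are 1/4, so \<open>x\<close>
    cannot vanish.\<close>
  define v :: "complex ^ 2" where "v = (\<chi> k. complex_of_real (1 / sqrt 2))"
  have "(norm v)\<^sup>2 = 1" by (simp add: norm_vec2 v_def norm_divide power_divide)
  then have "norm v = 1" using norm_ge_zero[of v] by (auto simp: power2_eq_1_iff)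
  then have "product_state v v \<in> ?S" by (intro product_state_separable)
  then have "f (product_state v v) 0 = Re (product_state v v $ (1, 1) $ (2, 2))"
    using x \<open>x = 0\<close> by metis
  moreover have "f (product_state v v) 0 = 0" using fl(1)[OF \<open>product_state v v \<in> ?S\<close>] by (rule linear_0)
  moreover have "product_state v v $ (1, 1) $ (2, 2) = of_real (1/4)"
    by (simp add: product_state_entry v_def flip: of_real_mult)
  ultimately show False by simp
qed

end
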